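(* Let $(X,p)$ be a partial metric space such that $p(x,x)=a$ for all $x\in X$, where $a$ is a fixed positive real number, and let $\mathcal{I}$ be an admissible ideal of $\mathbb{N}$. Then a sequence $\{x_n\}$ in $X$ is $\mathcal{I}$-bounded if and only if there exists a non-negative real number $r$ such that $\mathcal{I}\text{-}LIM^{r}x_n\neq\emptyset$.
   Context: A partial metric on a non-empty set $X$ is a function $p: X\times X \to [0,\infty)$ such that for all $x,y,z\in X$: (p1) $0\le p(x,x)\le p(x,y)$; (p2) $x=y$ if and only if $p(x,x)=p(x,y)=p(y,y)$; (p3) $p(x,y)=p(y,x)$; (p4) $p(x,y)\le p(x,z)+p(z,y)-p(z,z)$. Then $(X,p)$ is called a partial metric space. An ideal of $\mathbb{N}$ is a family $\mathcal{I}\subset 2^{\mathbb{N}}$ with $\emptyset\in\mathcal{I}$, closed under finite unions and under taking subsets. It is non-trivial if $\mathbb{N}\notin\mathcal{I}$ and $\mathcal{I}\neq\{\emptyset\}$. An admissible ideal is a non-trivial ideal containing $\{n\}$ for every $n\in\mathbb{N}$. A sequence $\{x_n\}$ in $X$ is $\mathcal{I}$-bounded if for any fixed $u\in X$ there exists a positive real number $M$ (possibly depending on $u$) such that $\{n\in\mathbb{N}: p(x_n,u)\ge M\}\in\mathcal{I}$. For $r\ge 0$, a sequence $\{x_n\}$ in $X$ is rough $\mathcal{I}$-convergent of roughness degree $r$ to $x\in X$ if for every $\varepsilon>0$ the set $\{n\in\mathbb{N}: |p(x_n,x)-p(x,x)|\ge r+\varepsilon\}$ belongs to $\mathcal{I}$.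 The rough $\mathcal{I}$-limit set $\mathcal{I}\text{-}LIM^{r}x_n$ is the set of all $x\in X$ to which $\{x_n\}$ is rough $\mathcal{I}$-convergent of roughness degree $r$. *)

theory Defs
  imports Complex_Main
begin

text \<open>The values of \<open>p\<close> are constrained on the carrier \<open>X\<close> only.\<close>

locale partial_metric_space =
  fixes X :: "'a set" and p :: "'a \<Rightarrow> 'a \<Rightarrow> real"
  assumes nonempty: "X \<noteq> {}"
    and self_nonneg: "x \<in> X \<Longrightarrow> 0 \<le> p x x"
    and self_le: "\<lbrakk>x \<in> X; y \<in> X\<rbrakk> \<Longrightarrow> p x x \<le> p x y"
    and eq_iff: "\<lbrakk>x \<in> X; y \<in> X\<rbrakk> \<Longrightarrow> x = y \<longleftrightarrow> p x x = p x y \<and> p x y = p y y"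
    and sym: "\<lbrakk>x \<in> X; y \<in> X\<rbrakk> \<Longrightarrow> p x y = p y x"
    and triangle: "\<lbrakk>x \<in> X; y \<in> X; z \<in> X\<rbrakk> \<Longrightarrow> p x y \<le> p x z + p z y - p z z"

definition ideal_on_nat :: "nat set set \<Rightarrow> bool" where
  "ideal_on_nat \<I> \<longleftrightarrow>
     {} \<in> \<I> \<and> (\<forall>A\<in>\<I>. \<forall>B\<in>\<I>. A \<union> B \<in> \<I>) \<and> (\<forall>A\<in>\<I>. \<forall>B. B \<subseteq> A \<longrightarrow> B \<in> \<I>)"

definition nontrivial_ideal :: "nat set set \<Rightarrow> bool" where
  "nontrivial_ideal \<I> \<longleftrightarrow> ideal_on_nat \<I> \<and> UNIV \<notin> \<I> \<and> \<I> \<noteq> {{}}"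

definition admissible_ideal :: "nat set set \<Rightarrow> bool" where
  "admissible_ideal \<I> \<longleftrightarrow> nontrivial_ideal \<I> \<and> (\<forall>n. {n} \<in> \<I>)"

definition ideal_bounded ::
    "'a set \<Rightarrow> ('a \<Rightarrow> 'a \<Rightarrow> real) \<Rightarrow> nat set set \<Rightarrow> (nat \<Rightarrow> 'a) \<Rightarrow> bool" where
  "ideal_bounded X p \<I> x \<longleftrightarrow> (\<forall>u\<in>X. \<exists>M>0. {n. p (x n) u \<ge> M} \<in> \<I>)"

definition rough_ideal_convergent ::
    "('a \<Rightarrow> 'a \<Rightarrow> real) \<Rightarrow> nat set set \<Rightarrow> real \<Rightarrow> (nat \<Rightarrow> 'a) \<Rightarrow> 'a \<Rightarrow> bool" where
  "rough_ideal_convergent p \<I> r x l \<longleftrightarrow>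
     (\<forall>\<epsilon>>0. {n. \<bar>p (x n) l - p l l\<bar> \<ge> r + \<epsilon>} \<in> \<I>)"

definition rough_ideal_limit_set ::
    "'a set \<Rightarrow> ('a \<Rightarrow> 'a \<Rightarrow> real) \<Rightarrow> nat set set \<Rightarrow> real \<Rightarrow> (nat \<Rightarrow> 'a) \<Rightarrow> 'a set" where
  "rough_ideal_limit_set X p \<I> r x = {l \<in> X. rough_ideal_convergent p \<I> r x l}"

end

theory Submission
  imports Defs
begin

text \<open>
  Self-distances are minimal, so \<open>\<bar>p (x n) l - p l l\<bar>\<close> is just \<open>p (x n) l - p l l\<close>.  Rough
  convergence to \<open>l\<close> of some degree therefore says that \<open>p (x n) l\<close> is bounded outside a member
  of the ideal, which is boundedness tested at the single point \<open>l\<close>.  The triangle inequality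
  carries such a bound from \<open>l\<close> to every other point \<open>u\<close>, at the cost of adding \<open>p l u\<close>.
  Conversely, a bound at any one point makes that point a rough limit whose degree is the bound.
\<close>

lemma ideal_on_nat_subset:
  assumes "ideal_on_nat \<I>" "A \<in> \<I>" "B \<subseteq> A"
  shows "B \<in> \<I>"
  using assms unfolding ideal_on_nat_def by blast

lemma (in partial_metric_space) abs_diff_self:
  assumes "y \<in> X" "l \<in> X"
  shows "\<bar>p y l - p l l\<bar> = p y l - p l l"
  using self_le[of l y] sym[of l y] assms by simp

text \<open>
  A term with \<open>p (x n) l - p l l \<ge> M + \<epsilon>\<close> also has \<open>p (x n) l \<ge> M\<close>, because \<open>p l l\<close> is
  nonnegative; hence the bound itself serves as roughness degree.
\<close>

lemma (in partial_metric_space) rough_ideal_convergent_if_bounded_at: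
  assumes "ideal_on_nat \<I>" "\<And>n. x n \<in> X" "l \<in> X"
    and bound: "{n. p (x n) l \<ge> M} \<in> \<I>"
  shows "rough_ideal_convergent p \<I> M x l"
  unfolding rough_ideal_convergent_def
proof (intro allI impI)
  fix \<epsilon> :: real
  assume "\<epsilon> > 0"
  then have "{n. \<bar>p (x n) l - p l l\<bar> \<ge> M + \<epsilon>} \<subseteq> {n. p (x n) l \<ge> M}"
    using self_nonneg[OF \<open>l \<in> X\<close>] by (auto simp: abs_diff_self assms)
  with \<open>ideal_on_nat \<I>\<close> bound show "{n. \<bar>p (x n) l - p l l\<bar> \<ge> M + \<epsilon>} \<in> \<I>"
    by (rule ideal_on_nat_subset)
qed

text \<open>
  The triangle inequality through \<open>l\<close> gives \<open>p (x n) u \<le> (p (x n) l - p l l) + p l u\<close>, so at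
  \<open>u\<close> any bound exceeding \<open>r + p l u\<close> fails only where the distance to \<open>l\<close> is already too large.
\<close>

lemma (in partial_metric_space) ideal_bounded_if_rough_ideal_convergent:
  assumes "ideal_on_nat \<I>" "\<And>n. x n \<in> X" "l \<in> X" "r \<ge> 0"
    and conv: "rough_ideal_convergent p \<I> r x l"
  shows "ideal_bounded X p \<I> x"
  unfolding ideal_bounded_def
proof
  fix u
  assume "u \<in> X"
  \<comment> \<open>The summand \<open>1\<close> is the \<open>\<epsilon>\<close> at which rough convergence is used; it also makes the bound
      strictly positive.\<close>
  define M where "M = r + 1 + p l u"
  have "0 \<le> p l u"
    using self_nonneg[of l] self_le[of l u] \<open>l \<in> X\<close> \<open>u \<in> X\<close> by simp
  then have "M > 0"
    using \<open>r \<ge> 0\<close> by (simp add: M_def)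
  have "p (x n) u \<le> p (x n) l + p l u - p l l" for n
    using triangle assms \<open>u \<in> X\<close> by blast
  then have "p (x n) l - p l l \<ge> r + 1" if "p (x n) u \<ge> M" for n
    using that unfolding M_def by (smt (verit))
  then have "{n. p (x n) u \<ge> M} \<subseteq> {n. \<bar>p (x n) l - p l l\<bar> \<ge> r + 1}"
    by (auto simp: abs_diff_self assms)
  moreover have "{n. \<bar>p (x n) l - p l l\<bar> \<ge> r + 1} \<in> \<I>"
    using conv unfolding rough_ideal_convergent_def by simp
  ultimately have "{n. p (x n) u \<ge> M} \<in> \<I>"
    using \<open>ideal_on_nat \<I>\<close> by (blast intro: ideal_on_nat_subset)
  with \<open>M > 0\<close> show "\<exists>M>0. {n. p (x n) u \<ge> M} \<in> \<I>"
    by blast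
qed

theorem theorem3p5:
  fixes X :: "'a set" and p :: "'a \<Rightarrow> 'a \<Rightarrow> real" and a :: real
    and \<I> :: "nat set set" and x :: "nat \<Rightarrow> 'a"
  assumes "partial_metric_space X p"
    and "a > 0"
    and "\<forall>y\<in>X. p y y = a"
    and "admissible_ideal \<I>"
    and "\<forall>n. x n \<in> X"
  shows "ideal_bounded X p \<I> x \<longleftrightarrow> (\<exists>r\<ge>0. rough_ideal_limit_set X p \<I> r x \<noteq> {})"
proof -
  interpret partial_metric_space X p by fact
  have ideal: "ideal_on_nat \<I>"
    using assms(4) unfolding admissible_ideal_def nontrivial_ideal_def by blast
  have in_X: "x n \<in> X" for n
    using assms(5) by blast
  show ?thesis
  proof
    assume bounded: "ideal_bounded X p \<I> x"
    obtain l where "l \<in> X"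
      using nonempty by blast
    then obtain M where "M > 0" "{n. p (x n) l \<ge> M} \<in> \<I>"
      using bounded unfolding ideal_bounded_def by blast
    then have "l \<in> rough_ideal_limit_set X p \<I> M x"
      using rough_ideal_convergent_if_bounded_at[of \<I> x l M] ideal in_X \<open>l \<in> X\<close>
      unfolding rough_ideal_limit_set_def by blast
    then show "\<exists>r\<ge>0. rough_ideal_limit_set X p \<I> r x \<noteq> {}"
      using \<open>M > 0\<close> by (intro exI[of _ M]) auto
  next
    assume "\<exists>r\<ge>0. rough_ideal_limit_set X p \<I> r x \<noteq> {}"
    then obtain r l where "r \<ge> 0" "l \<in> X" "rough_ideal_convergent p \<I> r x l"
      unfolding rough_ideal_limit_set_def by blast
    then show "ideal_bounded X p \<I> x"
      using ideal_bounded_if_rough_ideal_convergent[of \<I> x l r] ideal in_X by blast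
  qed
qed

end
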